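(* For any $1\le i<n$, any polynomial $f\in\Lambda_n(i)$, and any polynomial $g\in P_n$: $$A_i(f)=f\qquad\text{and}\qquad A_i(fg)=f\,A_i(g).$$
   Context: Let $F=\mathbb{C}(q)$ with $q$ an indeterminate and $P_n=F[x_1,\dots,x_n]$, on which $S_n$ acts by permuting variables; $s_i=(i,i+1)$. $\Lambda_n(i)\subset P_n$ is the subring of all polynomials invariant under $s_i$. Let $\partial_i(f)=(f-s_i(f))/(x_i-x_{i+1})$, let $X_i$ be the operator of multiplication by $x_i$, and let $A_i:=\partial_iX_i-qX_i\partial_i$ as an operator on $P_n$. *)

theory Defs
  imports
    "HOL-Computational_Algebra.Fraction_Field"
    "HOL-Computational_Algebra.Polynomial"
    "HOL-Combinatorics.Transposition"
    "HOL-Library.Poly_Mapping"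
begin

type_synonym ratfun = "complex poly fract"

definition q :: ratfun where
  "q = Fraction_Field.Fract [:0, 1:] 1"

text \<open>
  Polynomials over \<open>\<complex>(q)\<close> in the variables \<open>x\<^sub>0, x\<^sub>1, \<dots>\<close>: finitely supported maps from
  exponent vectors to coefficients, with the convolution product of \<^theory>\<open>HOL-Library.Poly_Mapping\<close>.
\<close>

type_synonym mpol = "(nat \<Rightarrow>\<^sub>0 nat) \<Rightarrow>\<^sub>0 ratfun"

definition var :: "nat \<Rightarrow> mpol" where
  "var i = Poly_Mapping.single (Poly_Mapping.single i 1) 1"

definition const :: "ratfun \<Rightarrow> mpol" where
  "const c = Poly_Mapping.single 0 c"

text \<open>\<open>P n\<close> is the subring of polynomials in which only \<open>x\<^sub>1, \<dots>, x\<^sub>n\<close> occur; \<open>x\<^sub>0\<close> is never used.\<close>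

definition P :: "nat \<Rightarrow> mpol set" where
  "P n = {f. \<forall>m \<in> Poly_Mapping.keys f. Poly_Mapping.keys m \<subseteq> {1..n}}"

text \<open>
  The coefficient of \<open>perm_act \<sigma> f\<close> at an exponent vector \<open>m\<close> is that of \<open>f\<close> at \<open>m \<circ> \<sigma>\<close>, that is,
  \<open>x\<^sub>j\<close> is replaced by \<open>x\<^bsub>\<sigma> j\<^esub>\<close>. The definition is meaningful only for bijective \<open>\<sigma>\<close>.
\<close>

definition perm_act :: "(nat \<Rightarrow> nat) \<Rightarrow> mpol \<Rightarrow> mpol" where
  "perm_act \<sigma> f = Poly_Mapping.map_key (Poly_Mapping.map_key \<sigma>) f"

definition s :: "nat \<Rightarrow> mpol \<Rightarrow> mpol" where
  "s i = perm_act (transpose i (i + 1))"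

definition \<Lambda> :: "nat \<Rightarrow> nat \<Rightarrow> mpol set" where
  "\<Lambda> n i = {f \<in> P n. s i f = f}"

text \<open>
  The exact quotient of \<open>f - s\<^sub>i f\<close> by \<open>x\<^sub>i - x\<^sub>i\<^sub>+\<^sub>1\<close>. For \<open>1 \<le> i < n\<close> and
  \<open>f \<in> P n\<close> it exists, is unique, and lies in \<open>P n\<close>: see \<open>divdiff_ex1\<close> and \<open>divdiff_in_P\<close> below.
\<close>

definition divdiff :: "nat \<Rightarrow> mpol \<Rightarrow> mpol" ("\<partial>") where
  "\<partial> i f = (THE h. h * (var i - var (i + 1)) = f - s i f)"

definition X :: "nat \<Rightarrow> mpol \<Rightarrow> mpol" where
  "X i f = var i * f"

definition A :: "nat \<Rightarrow> mpol \<Rightarrow> mpol" where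
  "A i f = \<partial> i (X i f) - const q * X i (\<partial> i f)"

lemma inj_map_key_perm:
  assumes "bij \<sigma>"
  shows "inj (Poly_Mapping.map_key \<sigma> :: (nat \<Rightarrow>\<^sub>0 nat) \<Rightarrow> _)"
proof (rule injI, rule poly_mapping_eqI)
  fix a b :: "nat \<Rightarrow>\<^sub>0 nat" and k
  assume e: "Poly_Mapping.map_key \<sigma> a = Poly_Mapping.map_key \<sigma> b"
  have i: "inj \<sigma>" using assms by (simp add: bij_is_inj)
  obtain j where "k = \<sigma> j" using assms by (metis bij_pointE)
  then show "Poly_Mapping.lookup a k = Poly_Mapping.lookup b k"
    using arg_cong[OF e, of "\<lambda>p. Poly_Mapping.lookup p j"]
    by (simp add: map_key.rep_eq i)
qed

lemma lookup_perm_act: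
  assumes "bij \<sigma>"
  shows "Poly_Mapping.lookup (perm_act \<sigma> f) m =
    Poly_Mapping.lookup f (Poly_Mapping.map_key \<sigma> m)"
  by (simp add: perm_act_def map_key.rep_eq inj_map_key_perm[OF assms])

lemma map_key_transpose_involutive:
  "Poly_Mapping.map_key (transpose i j) (Poly_Mapping.map_key (transpose i j) (m :: nat \<Rightarrow>\<^sub>0 nat)) = m"
  by (simp add: map_key_compose map_key_id[unfolded id_def[symmetric]])

lemma s_single:
  "s i (Poly_Mapping.single m c) =
    Poly_Mapping.single (Poly_Mapping.map_key (transpose i (i + 1)) m) c"
  by (rule poly_mapping_eqI)
    (auto simp: s_def lookup_perm_act lookup_single when_def map_key_transpose_involutive)

lemma s_add: "s i (f + g) = s i f + s i g"
  by (simp add: s_def perm_act_def inj_map_key_perm map_key_plus)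

lemma mpol_induct [case_names zero add]:
  fixes f :: mpol
  assumes "R 0"
    and "\<And>m c f. m \<notin> Poly_Mapping.keys f \<Longrightarrow> c \<noteq> 0 \<Longrightarrow> R f \<Longrightarrow> R (Poly_Mapping.single m c + f)"
  shows "R f"
proof (induction f rule: update_induct)
  case const
  show ?case by (rule assms(1))
next
  case (update f a b)
  have "Poly_Mapping.update a b f = Poly_Mapping.single a b + f"
    using update by (intro poly_mapping_eqI)
      (auto simp: lookup_update lookup_add lookup_single when_def in_keys_iff)
  then show ?case using assms(2) update by simp
qed

lemma s_mult_single:
  "s i (Poly_Mapping.single m c * f) = s i (Poly_Mapping.single m c) * s i f"
proof (induction f rule: mpol_induct)
  case zero
  show ?case by (simp add: s_def perm_act_def inj_map_key_perm)
next
  case (add m' c' f)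
  then show ?case
    by (simp add: distrib_left s_add mult_single s_single map_key_plus)
qed

lemma s_mult: "s i (f * g) = s i f * s i g"
proof (induction f rule: mpol_induct)
  case zero
  show ?case by (simp add: s_def perm_act_def inj_map_key_perm)
next
  case (add m c f)
  then show ?case by (simp add: distrib_right s_add s_mult_single)
qed

lemma s_const [simp]: "s i (const c) = const c"
  by (simp add: const_def s_single)

lemma s_var: "s i (var j) = var (transpose i (i + 1) j)"
proof -
  have "Poly_Mapping.map_key (transpose i (i + 1)) (Poly_Mapping.single j (1::nat)) =
      Poly_Mapping.single (transpose i (i + 1) j) 1"
    using map_key_single[of "transpose i (i + 1)" "transpose i (i + 1) j" "1::nat"] by simp
  then show ?thesis by (simp add: var_def s_single)
qed

lemma var_in_P: "1 \<le> i \<Longrightarrow> i \<le> n \<Longrightarrow> var i \<in> P n"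
  by (auto simp: var_def P_def)

lemma const_in_P: "const c \<in> P n"
  by (auto simp: const_def P_def)

lemma P_add: "f \<in> P n \<Longrightarrow> g \<in> P n \<Longrightarrow> f + g \<in> P n"
  using keys_add[of f g] by (fastforce simp: P_def)

lemma P_minus: "f \<in> P n \<Longrightarrow> - f \<in> P n"
  by (auto simp: P_def)

lemma P_mult:
  assumes "f \<in> P n" "g \<in> P n" shows "f * g \<in> P n"
proof -
  have "Poly_Mapping.keys m \<subseteq> {1..n}" if m: "m \<in> Poly_Mapping.keys (f * g)" for m
  proof -
    obtain a b where "m = a + b" "a \<in> Poly_Mapping.keys f" "b \<in> Poly_Mapping.keys g"
      using m keys_mult[of f g] by blast
    then show ?thesis using assms keys_add[of a b] unfolding P_def by blast
  qed
  then show ?thesis by (simp add: P_def)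
qed

lemma P_induct [consumes 1, case_names const var add mult]:
  assumes "f \<in> P n"
    and c: "\<And>c. R (const c)" and v: "\<And>j. 1 \<le> j \<Longrightarrow> j \<le> n \<Longrightarrow> R (var j)"
    and a: "\<And>f g. f \<in> P n \<Longrightarrow> g \<in> P n \<Longrightarrow> R f \<Longrightarrow> R g \<Longrightarrow> R (f + g)"
    and t: "\<And>f g. f \<in> P n \<Longrightarrow> g \<in> P n \<Longrightarrow> R f \<Longrightarrow> R g \<Longrightarrow> R (f * g)"
  shows "R f"
proof -
  have pow: "R (Poly_Mapping.single (Poly_Mapping.single j k) 1) \<and>
      Poly_Mapping.single (Poly_Mapping.single j k) 1 \<in> P n"
    if j: "1 \<le> j" "j \<le> n" for j k
  proof (induction k)
    case 0
    then show ?case using c[of 1] const_in_P[of 1 n] by (simp add: const_def)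
  next
    case (Suc k)
    have e: "Poly_Mapping.single (Poly_Mapping.single j (Suc k)) 1 =
      var j * Poly_Mapping.single (Poly_Mapping.single j k) 1"
      by (simp add: var_def mult_single single_add[symmetric])
    show ?case unfolding e using Suc t v P_mult var_in_P j by blast
  qed
  have mon: "R (Poly_Mapping.single m 1) \<and> Poly_Mapping.single m 1 \<in> P n"
    if "Poly_Mapping.keys m \<subseteq> {1..n}" for m :: "nat \<Rightarrow>\<^sub>0 nat"
    using that
  proof (induction m rule: update_induct)
    case const
    then show ?case using c[of 1] const_in_P[of 1 n] by (simp add: const_def)
  next
    case (update m j k)
    have u: "Poly_Mapping.update j k m = Poly_Mapping.single j k + m"
      using update by (intro poly_mapping_eqI)
        (auto simp: lookup_update lookup_add lookup_single when_def in_keys_iff)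
    have ks: "Poly_Mapping.keys (Poly_Mapping.update j k m) = insert j (Poly_Mapping.keys m)"
      using update by (auto simp: in_keys_iff lookup_update split: if_splits)
    have e: "Poly_Mapping.single (Poly_Mapping.update j k m) 1 =
      Poly_Mapping.single (Poly_Mapping.single j k) (1::ratfun) * Poly_Mapping.single m 1"
      by (simp add: u mult_single)
    show ?case unfolding e using update ks pow[of j k] t P_mult by simp
  qed
  have trm: "R (Poly_Mapping.single m d) \<and> Poly_Mapping.single m d \<in> P n"
    if "Poly_Mapping.keys m \<subseteq> {1..n}" for m :: "nat \<Rightarrow>\<^sub>0 nat" and d
  proof -
    have e: "Poly_Mapping.single m d = const d * Poly_Mapping.single m 1"
      by (simp add: const_def mult_single)
    show ?thesis unfolding e using mon[OF that] c t const_in_P P_mult by blast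
  qed
  show ?thesis using assms(1)
  proof (induction f rule: mpol_induct)
    case zero
    show ?case using c[of 0] by (simp add: const_def)
  next
    case (add m d f)
    have ks: "Poly_Mapping.keys (Poly_Mapping.single m d + f) = insert m (Poly_Mapping.keys f)"
      using add.hyps by (auto simp: in_keys_iff lookup_add lookup_single when_def split: if_splits)
    have f: "f \<in> P n" and m: "Poly_Mapping.keys m \<subseteq> {1..n}"
      using add.prems by (simp_all add: P_def ks)
    show ?case using a[OF _ f _ add.IH[OF f]] trm[OF m] by blast
  qed
qed

lemma var_diff_nonzero: "var i - var (i + 1) \<noteq> 0"
proof
  assume "var i - var (i + 1) = 0"
  then have "Poly_Mapping.lookup (var i) (Poly_Mapping.single i 1) =
    Poly_Mapping.lookup (var (i + 1)) (Poly_Mapping.single i 1)" by simp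
  moreover have "Poly_Mapping.single (Suc i) (1::nat) \<noteq> Poly_Mapping.single i 1"
    by (metis lookup_single_eq lookup_single_not_eq n_not_Suc_n one_neq_zero)
  ultimately show False by (simp add: var_def lookup_single_not_eq)
qed

lemma s_in_P:
  assumes "f \<in> P n" "1 \<le> i" "i < n" shows "s i f \<in> P n"
  using assms(1)
proof (induction rule: P_induct)
  case (var j)
  then show ?case using assms(2,3) by (auto simp: s_var transpose_def intro!: var_in_P)
qed (auto simp: s_add s_mult P_add P_mult const_in_P)

lemma divdiff_ex:
  assumes "f \<in> P n" "1 \<le> i" "i < n"
  shows "\<exists>h \<in> P n. h * (var i - var (i + 1)) = f - s i f"
  using assms(1)
proof (induction rule: P_induct)
  case (const c)
  show ?case using const_in_P[of 0 n] by (intro bexI[of _ "const 0"]) (simp_all, simp add: const_def)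
next
  case (var j)
  have 1: "1 \<in> P n" using const_in_P[of 1 n] by (simp add: const_def)
  have 0: "0 \<in> P n" using const_in_P[of 0 n] by (simp add: const_def)
  consider "j = i" | "j = i + 1" | "j \<noteq> i" "j \<noteq> i + 1" by blast
  then show ?case
  proof cases
    case 1 then show ?thesis using \<open>1 \<in> P n\<close> by (intro bexI[of _ 1]) (auto simp: s_var)
  next
    case 2 then show ?thesis using P_minus[OF \<open>1 \<in> P n\<close>] by (intro bexI[of _ "-1"]) (auto simp: s_var)
  next
    case 3 then show ?thesis using 0 by (intro bexI[of _ 0]) (auto simp: s_var transpose_def)
  qed
next
  case (add f g)
  then obtain h k where "h \<in> P n" "k \<in> P n"
    "h * (var i - var (i + 1)) = f - s i f" "k * (var i - var (i + 1)) = g - s i g" by blast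
  then show ?case by (intro bexI[of _ "h + k"]) (simp_all add: P_add distrib_right s_add)
next
  case (mult f g)
  then obtain h k where h: "h \<in> P n" "k \<in> P n"
    "h * (var i - var (i + 1)) = f - s i f" "k * (var i - var (i + 1)) = g - s i g" by blast
  have "(h * g + s i f * k) * (var i - var (i + 1)) =
      (h * (var i - var (i + 1))) * g + s i f * (k * (var i - var (i + 1)))"
    by (simp add: algebra_simps)
  also have "\<dots> = f * g - s i (f * g)"
    unfolding h s_mult by (simp add: left_diff_distrib right_diff_distrib)
  finally show ?case using h mult s_in_P[OF _ assms(2,3)]
    by (intro bexI[of _ "h * g + s i f * k"]) (simp_all add: P_add P_mult)
qed

lemma divdiff_ex1:
  assumes "f \<in> P n" "1 \<le> i" "i < n"
  shows "\<exists>!h. h * (var i - var (i + 1)) = f - s i f"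
proof -
  obtain h where "h * (var i - var (i + 1)) = f - s i f" using divdiff_ex[OF assms] by blast
  then show ?thesis
    using var_diff_nonzero[of i] by (metis mult_right_cancel)
qed

lemma divdiff_in_P:
  assumes "f \<in> P n" "1 \<le> i" "i < n"
  shows "\<partial> i f \<in> P n"
    and "\<partial> i f * (var i - var (i + 1)) = f - s i f"
proof -
  obtain h where h: "h \<in> P n" "h * (var i - var (i + 1)) = f - s i f"
    using divdiff_ex[OF assms] by blast
  then have "\<partial> i f = h"
    unfolding divdiff_def using divdiff_ex1[OF assms] by (intro the1_equality)
  then show "\<partial> i f \<in> P n" and "\<partial> i f * (var i - var (i + 1)) = f - s i f" using h by auto
qed

end

theory Submission
  imports Defs
begin

text \<open>The operator \<open>A i\<close> is linear over the \<open>s i\<close>-invariant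
  polynomials: \<open>\<partial> i\<close> is linear over them
  (\<open>divdiff_mult_invariant\<close>), and multiplication by \<open>var i\<close> commutes with
  multiplication by \<open>f\<close>. Hence \<open>A i f\<close> is \<open>f * A i 1\<close>, and
  \<open>A i 1 = 1\<close> because \<open>\<partial> i (var i) = 1\<close>, while the term with
  \<open>q\<close> vanishes as \<open>\<partial> i 1 = 0\<close>.\<close>

text \<open>Uniqueness of the quotient reduces computing \<open>\<partial> i f\<close> to checking a
  product identity for a candidate \<open>h\<close>.\<close>

lemma divdiff_eqI:
  assumes "f \<in> P n" "1 \<le> i" "i < n" and "h * (var i - var (i + 1)) = f - s i f"
  shows "\<partial> i f = h"
  using divdiff_ex1[OF assms(1-3)] divdiff_in_P(2)[OF assms(1-3)] assms(4) by blast

lemma one_in_P: "1 \<in> P n"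
  using const_in_P[of 1 n] by (simp add: const_def)

lemma s_one: "s i 1 = 1"
  using s_const[of i 1] by (simp add: const_def)

lemma divdiff_one:
  assumes "1 \<le> i" "i < n"
  shows "\<partial> i 1 = 0"
  by (rule divdiff_eqI[OF one_in_P assms]) (simp add: s_one)

lemma divdiff_var:
  assumes "1 \<le> i" "i < n"
  shows "\<partial> i (var i) = 1"
  by (rule divdiff_eqI[OF var_in_P assms]) (use assms in \<open>auto simp: s_var\<close>)

text \<open>As \<open>s i\<close> is multiplicative and fixes \<open>f\<close>, the factor
  \<open>f\<close> comes out of the numerator \<open>f * g - s i (f * g)\<close>.\<close>

lemma divdiff_mult_invariant:
  assumes "1 \<le> i" "i < n" "f \<in> \<Lambda> n i" "g \<in> P n"
  shows "\<partial> i (f * g) = f * \<partial> i g"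
proof (rule divdiff_eqI[OF _ assms(1,2)])
  have f: "f \<in> P n" "s i f = f"
    using assms(3) by (auto simp: \<Lambda>_def)
  show "f * g \<in> P n"
    using P_mult f(1) assms(4) .
  show "f * \<partial> i g * (var i - var (i + 1)) = f * g - s i (f * g)"
    unfolding mult.assoc divdiff_in_P(2)[OF assms(4,1,2)] s_mult f(2)
    by (rule right_diff_distrib)
qed

lemma A_one:
  assumes "1 \<le> i" "i < n"
  shows "A i 1 = 1"
  by (simp add: A_def X_def divdiff_one[OF assms] divdiff_var[OF assms])

lemma A_mult_invariant:
  assumes "1 \<le> i" "i < n" "f \<in> \<Lambda> n i" "g \<in> P n"
  shows "A i (f * g) = f * A i g"
proof -
  have "var i * g \<in> P n"
    using assms by (intro P_mult var_in_P) auto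
  \<comment> \<open>The linearity of \<open>\<partial> i\<close> is needed for
    \<open>var i * g\<close> as well as for \<open>g\<close>, since \<open>A i\<close> also
    differentiates after multiplying by \<open>var i\<close>.\<close>
  then have "\<partial> i (f * (var i * g)) = f * \<partial> i (var i * g)"
    using divdiff_mult_invariant assms(1-3) by blast
  then show ?thesis
    by (simp add: A_def X_def divdiff_mult_invariant[OF assms] right_diff_distrib mult.left_commute)
qed

theorem claim3p2:
  fixes n i :: nat and f g :: mpol
  assumes "1 \<le> i" and "i < n" and "f \<in> \<Lambda> n i" and "g \<in> P n"
  shows "A i f = f \<and> A i (f * g) = f * A i g"
  \<comment> \<open>The first equation is the second one at \<open>g = 1\<close>, combined with
    \<open>A i 1 = 1\<close>.\<close>
  using A_mult_invariant[OF assms(1-3) one_in_P] A_one[OF assms(1,2)] A_mult_invariant[OF assms]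
  by simp

end
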